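(* Let $\mathcal{M}=(E,r,m)$ be a ranked set with multiplicity. Then, as rational functions in $s,u_e,v_e$, $$\prod_{e\in E}(1-u_e)\;\mathbf{Z}_{\mathcal{M}}\Bigl(s,\bigl(\tfrac{v_e(1-2u_e)}{1-u_e}\bigr)_{e\in E}\Bigr)=\sum_{A\subseteq E}s^{-r(A)}\prod_{e\in A}(-v_e)\;\mathbf{Z}_{\mathcal{M}/A}\bigl(s,(v_e)_{e\in E\setminus A}\bigr)\prod_{e\in A}u_e\prod_{e\in E\setminus A}(1-u_e).$$ Consequently, with $R=\mathbb{R}$ and $p_e\in[0,1]$, $$\mathbb{E}\Bigl[s^{-r(E_{\underline p})}\prod_{e\in E_{\underline p}}(-v_e)\;\mathbf{Z}_{\mathcal{M}/E_{\underline p}}\bigl(s,(v_e)_{e\in E\setminus E_{\underline p}}\bigr)\Bigr]=\prod_{e\in E}(1-p_e)\;\mathbf{Z}_{\mathcal{M}}\Bigl(s,\bigl(\tfrac{v_e(1-2p_e)}{1-p_e}\bigr)_{e\in E}\Bigr).$$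
   Context: A ranked set with multiplicity (rsm) is $\mathcal{M}=(E,r,m)$ with $E$ finite, $r:2^E\to\mathbb{Z}$ arbitrary ($r(\emptyset)$ may be nonzero), $m:2^E\to R$ arbitrary, $R$ a commutative ring with $1$. $\mathbf{Z}_{\mathcal{M}}(q,(v_e))=\sum_{A\subseteq E}m(A)q^{-r(A)}\prod_{e\in A}v_e$. Contraction $\mathcal{M}/A=(E\setminus A,r',m')$ with $r'(B)=r(B\cup A)-r(A)$, $m'(B)=m(B\cup A)$. $E_{\underline p}$ is the random subset containing each $e$ independently with probability $p_e$. The right-hand side of the expectation formula equals the polynomial $\sum_{A\subseteq E}m(A)s^{-r(A)}\prod_{e\in A}v_e(1-2p_e)\prod_{e\in E\setminus A}(1-p_e)$. *)

theory Defs
  imports "HOL-Library.Poly_Mapping" "HOL-Probability.Probability" "HOL-Probability.Product_PMF"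
begin

section \<open>The total ring of fractions of a commutative ring\<close>

text \<open>
  The coefficient ring is an arbitrary commutative ring, possibly with zero divisors, so the
  fraction field of \<open>HOL-Computational_Algebra\<close> (which needs an integral domain) is not
  applicable. The denominators allowed here are the elements that are not zero divisors; with
  such denominators the canonical map from the ring into its ring of fractions is injective.
\<close>

definition regular :: "'a::comm_ring_1 \<Rightarrow> bool" where
  "regular b \<longleftrightarrow> (\<forall>x. b * x = 0 \<longrightarrow> x = 0)"

lemma regular_1 [simp]: "regular 1"
  by (simp add: regular_def)

lemma regular_mult [simp]: "regular a \<Longrightarrow> regular b \<Longrightarrow> regular (a * b)"
  unfolding regular_def by (metis mult.assoc)

lemma regular_cancel:
  assumes "regular c" "c * a = c * b"
  shows "a = b"
proof -
  have "c * (a - b) = 0" using assms(2) by (simp add: right_diff_distrib)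
  then have "a - b = 0" using assms(1) unfolding regular_def by blast
  then show ?thesis by simp
qed

definition tfractrel :: "'a::comm_ring_1 \<times> 'a \<Rightarrow> 'a \<times> 'a \<Rightarrow> bool" where
  "tfractrel x y \<longleftrightarrow> regular (snd x) \<and> regular (snd y) \<and> fst x * snd y = fst y * snd x"

lemma part_equivp_tfractrel: "part_equivp (tfractrel :: 'a::comm_ring_1 \<times> 'a \<Rightarrow> _)"
proof (rule part_equivpI)
  show "\<exists>x::'a \<times> 'a. tfractrel x x"
    by (rule exI[where x = "(0, 1)"]) (simp add: tfractrel_def)
  show "symp (tfractrel :: 'a \<times> 'a \<Rightarrow> _)"
    by (simp add: symp_def tfractrel_def)
  show "transp (tfractrel :: 'a \<times> 'a \<Rightarrow> _)"
  proof (rule transpI)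
    fix x y z :: "'a \<times> 'a"
    assume A: "tfractrel x y" and B: "tfractrel y z"
    have "snd y * (fst x * snd z) = (fst x * snd y) * snd z" by (simp only: ac_simps)
    also have "fst x * snd y = fst y * snd x" using A by (simp only: tfractrel_def)
    also have "(fst y * snd x) * snd z = (fst y * snd z) * snd x" by (simp only: ac_simps)
    also have "fst y * snd z = fst z * snd y" using B by (simp only: tfractrel_def)
    also have "(fst z * snd y) * snd x = snd y * (fst z * snd x)" by (simp only: ac_simps)
    finally have *: "snd y * (fst x * snd z) = snd y * (fst z * snd x)" .
    have "regular (snd y)" using A by (simp add: tfractrel_def)
    from regular_cancel[OF this *] have "fst x * snd z = fst z * snd x" .
    with A B show "tfractrel x z" by (simp add: tfractrel_def)
  qed
qed

quotient_type (overloaded) 'a tfract = "'a::comm_ring_1 \<times> 'a" / partial: tfractrel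
  by (rule part_equivp_tfractrel)

lift_definition TFract :: "'a::comm_ring_1 \<Rightarrow> 'a \<Rightarrow> 'a tfract"
  is "\<lambda>a b. if regular b then (a, b) else (0, 1)"
  by (simp add: tfractrel_def)

lemma TFract_cases [cases type: tfract]:
  obtains (TFract) a b where "q = TFract a b" "regular b"
  by transfer (auto simp: tfractrel_def split: if_splits)

lemma eq_tfract:
  "regular b \<Longrightarrow> regular d \<Longrightarrow> TFract a b = TFract c d \<longleftrightarrow> a * d = c * b"
  by transfer (simp add: tfractrel_def)

instantiation tfract :: (comm_ring_1) comm_ring_1
begin

lift_definition zero_tfract :: "'a tfract" is "(0, 1)" by (simp add: tfractrel_def)

lift_definition one_tfract :: "'a tfract" is "(1, 1)" by (simp add: tfractrel_def)

lift_definition plus_tfract :: "'a tfract \<Rightarrow> 'a tfract \<Rightarrow> 'a tfract"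
  is "\<lambda>q r. (fst q * snd r + fst r * snd q, snd q * snd r)"
proof -
  fix p q r s :: "'a \<times> 'a"
  assume A: "tfractrel p q" and B: "tfractrel r s"
  have "(fst p * snd r + fst r * snd p) * (snd q * snd s)
      = (fst p * snd q) * (snd r * snd s) + (fst r * snd s) * (snd p * snd q)"
    by (simp add: algebra_simps)
  also have "\<dots> = (fst q * snd p) * (snd r * snd s) + (fst s * snd r) * (snd p * snd q)"
    using A B by (simp add: tfractrel_def)
  also have "\<dots> = (fst q * snd s + fst s * snd q) * (snd p * snd r)"
    by (simp add: algebra_simps)
  finally show "tfractrel (fst p * snd r + fst r * snd p, snd p * snd r)
                          (fst q * snd s + fst s * snd q, snd q * snd s)"
    using A B by (simp add: tfractrel_def)
qed

lift_definition uminus_tfract :: "'a tfract \<Rightarrow> 'a tfract" is "\<lambda>x. (- fst x, snd x)"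
  by (simp add: tfractrel_def)

definition minus_tfract :: "'a tfract \<Rightarrow> 'a tfract \<Rightarrow> 'a tfract" where
  "minus_tfract q r = q + - r"

lift_definition times_tfract :: "'a tfract \<Rightarrow> 'a tfract \<Rightarrow> 'a tfract"
  is "\<lambda>q r. (fst q * fst r, snd q * snd r)"
proof -
  fix p q r s :: "'a \<times> 'a"
  assume A: "tfractrel p q" and B: "tfractrel r s"
  have "(fst p * fst r) * (snd q * snd s) = (fst p * snd q) * (fst r * snd s)"
    by (simp add: ac_simps)
  also have "\<dots> = (fst q * snd p) * (fst s * snd r)"
    using A B by (simp add: tfractrel_def)
  also have "\<dots> = (fst q * fst s) * (snd p * snd r)"
    by (simp add: ac_simps)
  finally show "tfractrel (fst p * fst r, snd p * snd r) (fst q * fst s, snd q * snd s)"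
    using A B by (simp add: tfractrel_def)
qed

lemma Zero_tfract_def: "0 = TFract 0 1"
  by transfer (simp add: tfractrel_def)

lemma One_tfract_def: "1 = TFract 1 1"
  by transfer (simp add: tfractrel_def)

lemma add_tfract [simp]:
  "regular b \<Longrightarrow> regular d \<Longrightarrow> TFract a b + TFract c d = TFract (a * d + c * b) (b * d)"
  by transfer (simp add: tfractrel_def)

lemma uminus_tfract [simp]: "regular b \<Longrightarrow> - TFract a b = TFract (- a) b"
  by transfer (simp add: tfractrel_def)

lemma mult_tfract [simp]:
  "regular b \<Longrightarrow> regular d \<Longrightarrow> TFract a b * TFract c d = TFract (a * c) (b * d)"
  by transfer (simp add: tfractrel_def)

instance
proof
  fix q r s :: "'a tfract"
  show "(q * r) * s = q * (r * s)"
    by (cases q, cases r, cases s) (simp add: eq_tfract algebra_simps)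
  show "q * r = r * q"
    by (cases q, cases r) (simp add: eq_tfract algebra_simps)
  show "1 * q = q"
    by (cases q) (simp add: One_tfract_def eq_tfract)
  show "(q + r) + s = q + (r + s)"
    by (cases q, cases r, cases s) (simp add: eq_tfract algebra_simps)
  show "q + r = r + q"
    by (cases q, cases r) (simp add: eq_tfract algebra_simps)
  show "0 + q = q"
    by (cases q) (simp add: Zero_tfract_def eq_tfract)
  show "- q + q = 0"
    by (cases q) (simp add: Zero_tfract_def eq_tfract)
  show "q - r = q + - r"
    by (simp add: minus_tfract_def)
  show "(q + r) * s = q * s + r * s"
    by (cases q, cases r, cases s) (simp add: eq_tfract algebra_simps)
  show "(0::'a tfract) \<noteq> 1"
    by (simp add: Zero_tfract_def One_tfract_def eq_tfract)
qed

end

text \<open>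
  An element \<open>a / b\<close> is invertible iff \<open>a\<close> is not a zero divisor; the inverse of
  a non-invertible element is set to \<open>0\<close> by convention.
\<close>

instantiation tfract :: (comm_ring_1) inverse
begin

lift_definition inverse_tfract :: "'a tfract \<Rightarrow> 'a tfract"
  is "\<lambda>x. if regular (fst x) then (snd x, fst x) else (0, 1)"
proof -
  have *: "regular (fst q)" if "tfractrel p q" "regular (fst p)" for p q :: "'a \<times> 'a"
    unfolding regular_def
  proof (intro allI impI)
    fix x assume "fst q * x = 0"
    then have "(fst q * snd p) * x = 0" 
      by (simp add: mult.commute[of "fst q"] mult.assoc)
    then have "(fst p * snd q) * x = 0" using that(1) by (simp only: tfractrel_def)
    moreover have "regular (fst p * snd q)" using that regular_mult unfolding tfractrel_def by metis
    ultimately show "x = 0" unfolding regular_def by blast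
  qed
  fix p q :: "'a \<times> 'a"
  assume A: "tfractrel p q"
  then have "tfractrel q p" by (simp add: tfractrel_def)
  with A * have "regular (fst p) \<longleftrightarrow> regular (fst q)" by blast
  with A show "tfractrel (if regular (fst p) then (snd p, fst p) else (0, 1))
                         (if regular (fst q) then (snd q, fst q) else (0, 1))"
    by (simp add: tfractrel_def mult.commute[of "snd p"] mult.commute[of "snd q"])
qed

definition divide_tfract :: "'a tfract \<Rightarrow> 'a tfract \<Rightarrow> 'a tfract" where
  "divide_tfract q r = q * inverse r"

instance ..

end

lemma inverse_tfract [simp]: "regular a \<Longrightarrow> regular b \<Longrightarrow> inverse (TFract a b) = TFract b a"
  by transfer (simp add: tfractrel_def)


section \<open>Rational functions in the indeterminates \<open>s\<close>, \<open>u\<^sub>e\<close>, \<open>v\<^sub>e\<close>\<close>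

datatype 'e indet = S_var | U_var 'e | V_var 'e

text \<open>Polynomials over \<open>'r\<close> are finitely supported maps from monomials to coefficients.\<close>

type_synonym ('e, 'r) ratfun = "(('e indet \<Rightarrow>\<^sub>0 nat) \<Rightarrow>\<^sub>0 'r) tfract"

definition rf_const :: "'r::comm_ring_1 \<Rightarrow> ('e, 'r) ratfun" where
  "rf_const c = TFract (Poly_Mapping.single 0 c) 1"

definition rf_var :: "'e indet \<Rightarrow> ('e, 'r::comm_ring_1) ratfun" where
  "rf_var x = TFract (Poly_Mapping.single (Poly_Mapping.single x 1) 1) 1"


section \<open>Ranked sets with multiplicity\<close>

text \<open>
  Only the values of rank and multiplicity on subsets of the ground set are ever used.
\<close>

record ('e, 'r) rsm =
  ground :: "'e set"
  rk :: "'e set \<Rightarrow> int"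
  rsm_mult :: "'e set \<Rightarrow> 'r"

definition contraction :: "('e, 'r) rsm \<Rightarrow> 'e set \<Rightarrow> ('e, 'r) rsm" where
  "contraction M A = \<lparr> ground = ground M - A,
     rk = (\<lambda>B. rk M (B \<union> A) - rk M A),
     rsm_mult = (\<lambda>B. rsm_mult M (B \<union> A)) \<rparr>"

text \<open>
  The first argument is the structure map of the \<open>'r\<close>-algebra \<open>'k\<close> from which the
  values substituted for \<open>q\<close> and \<open>v\<^sub>e\<close> are taken.
\<close>

definition Zpoly ::
  "('r \<Rightarrow> 'k) \<Rightarrow> ('e, 'r) rsm \<Rightarrow> 'k::{comm_ring_1, inverse} \<Rightarrow> ('e \<Rightarrow> 'k) \<Rightarrow> 'k" where
  "Zpoly \<iota> M q v = (\<Sum>A\<in>Pow (ground M). \<iota> (rsm_mult M A) * q powi (- rk M A) * (\<Prod>e\<in>A. v e))"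

definition random_subset :: "'e set \<Rightarrow> ('e \<Rightarrow> real) \<Rightarrow> 'e set pmf" where
  "random_subset E p =
     map_pmf (\<lambda>f. {e \<in> E. f e}) (Pi_pmf E False (\<lambda>e. bernoulli_pmf (p e)))"

end

theory Submission
  imports Defs
begin

text \<open>
  Give every element of \<open>E\<close> two weights: \<open>x e\<close> if it lies in the subset and \<open>y e\<close> if it does
  not. For the resulting homogeneous form \<open>H M x y\<close> of the partition function, splitting each
  subset \<open>C\<close> into \<open>A\<close> and \<open>C - A\<close> in all possible ways and expanding \<open>\<Prod>e\<in>C. x e + y e\<close> gives
  \<open>(\<Sum>A. s powi (- rk M A) * (\<Prod>e\<in>A. x e) * H (M / A) y z) = H M (x + y) z\<close>. Both sides
  of the theorem equal \<open>H M (v * (1 - 2 * u)) (1 - u)\<close>: the sum over contractions is the case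
  \<open>x = - v * u\<close>, \<open>y = (1 - u) * v\<close>, \<open>z = 1 - u\<close>, and the product on the other side
  homogenizes the partition function. The elements \<open>s\<close> and \<open>1 - u e\<close> of the
  ring of fractions are invertible because as polynomials they have lowest coefficient \<open>1\<close>.
\<close>


section \<open>Integer powers of a unit\<close>

lemma power_int_diff_of_nat_unit:
  fixes x :: "'k::{comm_monoid_mult, inverse}"
  assumes "x * inverse x = 1"
  shows "x powi (int m - int n) = x ^ m * inverse x ^ n"
proof -
  have unit_power: "x ^ k * inverse x ^ k = 1" for k
    using assms by (simp flip: power_mult_distrib)
  show ?thesis
  proof (cases "n \<le> m")
    case True
    then obtain k where m: "m = n + k" using le_Suc_ex by blast
    have "x ^ m * inverse x ^ n = x ^ k * (x ^ n * inverse x ^ n)"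
      by (simp add: m power_add ac_simps)
    then show ?thesis by (simp add: m unit_power)
  next
    case False
    then obtain k where n: "n = m + k" using le_Suc_ex nat_le_linear by blast
    have "x ^ m * inverse x ^ n = inverse x ^ k * (x ^ m * inverse x ^ m)"
      by (simp add: n power_add ac_simps)
    then show ?thesis using False by (simp add: n unit_power power_int_def)
  qed
qed

lemma power_int_add_unit:
  fixes x :: "'k::{comm_monoid_mult, inverse}"
  assumes "x * inverse x = 1"
  shows "x powi (i + j) = x powi i * x powi j"
proof -
  obtain a b where i: "i = int a - int b" by (cases i rule: int_diff_cases)
  obtain c d where j: "j = int c - int d" by (cases j rule: int_diff_cases)
  have "i + j = int (a + c) - int (b + d)" by (simp add: i j)
  then have "x powi (i + j) = x ^ (a + c) * inverse x ^ (b + d)"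
    by (simp only: power_int_diff_of_nat_unit[OF assms])
  also have "\<dots> = x powi i * x powi j"
    by (simp add: i j power_int_diff_of_nat_unit[OF assms] power_add ac_simps)
  finally show ?thesis .
qed


section \<open>Invertible rational functions\<close>

definition total_degree :: "('x \<Rightarrow>\<^sub>0 nat) \<Rightarrow> nat" where
  "total_degree k = Sum_any (Poly_Mapping.lookup k)"

lemma total_degree_add: "total_degree (k + l) = total_degree k + total_degree l"
  by (simp add: total_degree_def lookup_add Sum_any.distrib)

lemma total_degree_eq_0_iff: "total_degree k = 0 \<longleftrightarrow> k = 0"
  by (simp add: total_degree_def poly_mapping_eq_iff fun_eq_iff)

lemma lookup_single_mult_add:
  fixes f :: "'a::cancel_comm_monoid_add \<Rightarrow>\<^sub>0 'r::semiring_0"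
  shows "Poly_Mapping.lookup (Poly_Mapping.single k c * f) (k + m) = c * Poly_Mapping.lookup f m"
  by (simp add: lookup_mult lookup_single when_mult)

lemma regular_if_lowest_coeff_regular:
  fixes p :: "('x \<Rightarrow>\<^sub>0 nat) \<Rightarrow>\<^sub>0 'r::comm_ring_1"
  assumes regular: "regular (Poly_Mapping.lookup p k)"
    and lowest: "\<And>l. l \<in> Poly_Mapping.keys p \<Longrightarrow> l \<noteq> k \<Longrightarrow> total_degree k < total_degree l"
  shows "regular p"
  unfolding regular_def
proof (intro allI impI, rule ccontr)
  fix f assume zero: "p * f = 0" and "f \<noteq> 0"
  then obtain m where m: "m \<in> Poly_Mapping.keys f"
    and m_min: "\<And>n. n \<in> Poly_Mapping.keys f \<Longrightarrow> total_degree m \<le> total_degree n"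
    using ex_min_if_finite[of "total_degree ` Poly_Mapping.keys f"]
    by (auto simp: not_less)
  let ?c = "Poly_Mapping.lookup p k"
  define q where "q = p - Poly_Mapping.single k ?c"
  have q_degree: "total_degree k < total_degree l" if "l \<in> Poly_Mapping.keys q" for l
    using that lowest[of l]
    by (auto simp: q_def in_keys_iff lookup_minus lookup_single when_def split: if_splits)
  have "k + m \<notin> Poly_Mapping.keys (q * f)"
  proof
    assume "k + m \<in> Poly_Mapping.keys (q * f)"
    then obtain l n where "l \<in> Poly_Mapping.keys q" "n \<in> Poly_Mapping.keys f" "k + m = l + n"
      using keys_mult[of q f] by auto
    then show False
      using q_degree[of l] m_min[of n] total_degree_add[of k m] total_degree_add[of l n] by simp
  qed
  moreover have "p * f = Poly_Mapping.single k ?c * f + q * f"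
    by (simp add: q_def algebra_simps)
  ultimately have "?c * Poly_Mapping.lookup f m = 0"
    using zero lookup_single_mult_add[of k ?c f m]
    by (metis add.right_neutral in_keys_iff lookup_add lookup_zero)
  then show False
    using regular m by (auto simp: regular_def in_keys_iff)
qed

lemma TFract_mult_inverse:
  assumes "regular a" "regular b"
  shows "TFract a b * inverse (TFract a b) = 1"
  using assms by (simp add: One_tfract_def eq_tfract mult.commute)

lemma rf_var_mult_inverse:
  "rf_var x * inverse (rf_var x) = (1 :: ('e, 'r::comm_ring_1) ratfun)"
proof -
  have "regular (Poly_Mapping.single (Poly_Mapping.single x (1::nat)) (1::'r))"
    by (rule regular_if_lowest_coeff_regular[where k = "Poly_Mapping.single x 1"]) auto
  then show ?thesis
    unfolding rf_var_def by (intro TFract_mult_inverse) simp_all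
qed

lemma one_minus_rf_var_mult_divide:
  "(1 - rf_var x) * (q / (1 - rf_var x)) = (q :: ('e, 'r::comm_ring_1) ratfun)"
proof -
  let ?p = "1 - Poly_Mapping.single (Poly_Mapping.single x (1::nat)) (1::'r)"
  have "Poly_Mapping.single x (1::nat) \<noteq> 0"
    by (metis lookup_single_eq lookup_zero zero_neq_one)
  then have "Poly_Mapping.lookup ?p 0 = 1"
    by (simp add: lookup_minus lookup_single)
  moreover have "total_degree 0 < total_degree l" if "l \<noteq> 0" for l :: "'e indet \<Rightarrow>\<^sub>0 nat"
    using that total_degree_eq_0_iff by (metis gr0I)
  ultimately have "regular ?p"
    by (intro regular_if_lowest_coeff_regular[where k = 0]) auto
  moreover have "1 - rf_var x = TFract ?p 1"
    by (simp add: rf_var_def One_tfract_def minus_tfract_def)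
  ultimately have "(1 - rf_var x) * inverse (1 - rf_var x) = (1 :: ('e, 'r) ratfun)"
    by (simp only: TFract_mult_inverse regular_1)
  then show ?thesis
    by (simp add: divide_tfract_def mult.left_commute)
qed


section \<open>The homogeneous partition function\<close>

definition Zpoly_homog ::
  "('r \<Rightarrow> 'k) \<Rightarrow> ('e, 'r) rsm \<Rightarrow> 'k::{comm_ring_1, inverse} \<Rightarrow> ('e \<Rightarrow> 'k) \<Rightarrow> ('e \<Rightarrow> 'k) \<Rightarrow> 'k" where
  "Zpoly_homog \<iota> M q x y =
     (\<Sum>A\<in>Pow (ground M). \<iota> (rsm_mult M A) * q powi (- rk M A)
        * (\<Prod>e\<in>A. x e) * (\<Prod>e\<in>ground M - A. y e))"

lemma ground_contraction: "ground (contraction M A) = ground M - A"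
  by (simp add: contraction_def)

lemma prod_mult_Zpoly:
  assumes "finite (ground M)" and x: "\<And>e. e \<in> ground M \<Longrightarrow> y e * v e = x e"
  shows "(\<Prod>e\<in>ground M. y e) * Zpoly \<iota> M q v = Zpoly_homog \<iota> M q x y"
  unfolding Zpoly_def Zpoly_homog_def sum_distrib_left
proof (intro sum.cong refl)
  fix A assume A: "A \<in> Pow (ground M)"
  have "(\<Prod>e\<in>ground M. y e) = (\<Prod>e\<in>ground M - A. y e) * (\<Prod>e\<in>A. y e)"
    using A assms(1) by (intro prod.subset_diff) auto
  moreover have "(\<Prod>e\<in>A. x e) = (\<Prod>e\<in>A. y e) * (\<Prod>e\<in>A. v e)"
    unfolding prod.distrib[symmetric] using A by (intro prod.cong refl) (auto simp: x)
  ultimately show "(\<Prod>e\<in>ground M. y e) * (\<iota> (rsm_mult M A) * q powi (- rk M A) * (\<Prod>e\<in>A. v e))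
      = \<iota> (rsm_mult M A) * q powi (- rk M A) * (\<Prod>e\<in>A. x e) * (\<Prod>e\<in>ground M - A. y e)"
    by (simp only: ac_simps)
qed

lemma sum_Pow_Pow_Diff:
  fixes f :: "'a set \<Rightarrow> 'a set \<Rightarrow> 'b::comm_monoid_add"
  assumes "finite E"
  shows "(\<Sum>A\<in>Pow E. \<Sum>B\<in>Pow (E - A). f A B) = (\<Sum>C\<in>Pow E. \<Sum>A\<in>Pow C. f A (C - A))"
proof -
  have "(\<Sum>A\<in>Pow E. \<Sum>B\<in>Pow (E - A). f A B)
      = (\<Sum>(A, B)\<in>Sigma (Pow E) (\<lambda>A. Pow (E - A)). f A B)"
    using assms by (intro sum.Sigma) auto
  also have "\<dots> = (\<Sum>(C, A)\<in>Sigma (Pow E) Pow. f A (C - A))"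
    by (rule sum.reindex_bij_witness[where i = "\<lambda>(C, A). (A, C - A)" and j = "\<lambda>(A, B). (A \<union> B, A)"])
      (auto intro!: arg_cong[where f = "f _"])
  also have "\<dots> = (\<Sum>C\<in>Pow E. \<Sum>A\<in>Pow C. f A (C - A))"
    using assms by (intro sum.Sigma[symmetric]) (auto intro: finite_subset)
  finally show ?thesis .
qed

lemma sum_Zpoly_homog_contraction:
  fixes s :: "'k::{comm_ring_1, inverse}"
  assumes fin: "finite (ground M)" and s: "s * inverse s = 1"
  shows "(\<Sum>A\<in>Pow (ground M).
            s powi (- rk M A) * (\<Prod>e\<in>A. x e) * Zpoly_homog \<iota> (contraction M A) s y z)
       = Zpoly_homog \<iota> M s (\<lambda>e. x e + y e) z"
proof -
  let ?E = "ground M"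
  let ?t = "\<lambda>C. \<iota> (rsm_mult M C) * s powi (- rk M C)"
  have diff_diff: "?E - A - B = ?E - (B \<union> A)" for A B by blast
  have absorb_rank: "s powi (- rk M A) * a * (i * s powi (- (rk M (B \<union> A) - rk M A)) * b * c)
      = i * s powi (- rk M (B \<union> A)) * (a * b) * c" for A B a b c i
  proof -
    have "s powi (- rk M (B \<union> A)) = s powi (- rk M A) * s powi (- (rk M (B \<union> A) - rk M A))"
      by (simp flip: power_int_add_unit[OF s])
    then show ?thesis by (simp only: ac_simps)
  qed
  have "(\<Sum>A\<in>Pow ?E. s powi (- rk M A) * (\<Prod>e\<in>A. x e) * Zpoly_homog \<iota> (contraction M A) s y z)
      = (\<Sum>A\<in>Pow ?E. \<Sum>B\<in>Pow (?E - A).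
           ?t (B \<union> A) * ((\<Prod>e\<in>A. x e) * (\<Prod>e\<in>B. y e)) * (\<Prod>e\<in>?E - (B \<union> A). z e))"
    by (simp only: Zpoly_homog_def contraction_def rsm.simps sum_distrib_left absorb_rank diff_diff)
  also have "\<dots> = (\<Sum>C\<in>Pow ?E. \<Sum>A\<in>Pow C.
      ?t C * ((\<Prod>e\<in>A. x e) * (\<Prod>e\<in>C - A. y e)) * (\<Prod>e\<in>?E - C. z e))"
    unfolding sum_Pow_Pow_Diff[OF fin] by (intro sum.cong refl) (simp add: Un_absorb2)
  also have "\<dots> = Zpoly_homog \<iota> M s (\<lambda>e. x e + y e) z"
    unfolding Zpoly_homog_def
  proof (intro sum.cong refl)
    fix C assume "C \<in> Pow ?E"
    then have "finite C" using fin by (auto intro: finite_subset)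
    then show "(\<Sum>A\<in>Pow C. ?t C * ((\<Prod>e\<in>A. x e) * (\<Prod>e\<in>C - A. y e)) * (\<Prod>e\<in>?E - C. z e))
        = ?t C * (\<Prod>e\<in>C. x e + y e) * (\<Prod>e\<in>?E - C. z e)"
      by (simp add: prod_add sum_distrib_left sum_distrib_right)
  qed
  finally show ?thesis .
qed

lemma sum_Zpoly_contraction:
  fixes s :: "'k::{comm_ring_1, inverse}"
  assumes fin: "finite (ground M)" and s: "s * inverse s = 1"
  shows "(\<Sum>A\<in>Pow (ground M). s powi (- rk M A) * (\<Prod>e\<in>A. - v e)
             * Zpoly \<iota> (contraction M A) s v
             * (\<Prod>e\<in>A. u e) * (\<Prod>e\<in>ground M - A. 1 - u e))
       = Zpoly_homog \<iota> M s (\<lambda>e. v e * (1 - 2 * u e)) (\<lambda>e. 1 - u e)"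
proof -
  have homogenize: "Zpoly_homog \<iota> (contraction M A) s (\<lambda>e. (1 - u e) * v e) (\<lambda>e. 1 - u e)
      = (\<Prod>e\<in>ground M - A. 1 - u e) * Zpoly \<iota> (contraction M A) s v" for A
    using fin
    by (intro prod_mult_Zpoly[of "contraction M A", unfolded ground_contraction, symmetric]) simp_all
  have "(\<Sum>A\<in>Pow (ground M). s powi (- rk M A) * (\<Prod>e\<in>A. - v e)
             * Zpoly \<iota> (contraction M A) s v
             * (\<Prod>e\<in>A. u e) * (\<Prod>e\<in>ground M - A. 1 - u e))
      = (\<Sum>A\<in>Pow (ground M). s powi (- rk M A) * (\<Prod>e\<in>A. - v e * u e)
             * Zpoly_homog \<iota> (contraction M A) s (\<lambda>e. (1 - u e) * v e) (\<lambda>e. 1 - u e))"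
    unfolding prod.distrib homogenize by (simp only: ac_simps)
  also have "\<dots> = Zpoly_homog \<iota> M s (\<lambda>e. - v e * u e + (1 - u e) * v e) (\<lambda>e. 1 - u e)"
    by (rule sum_Zpoly_homog_contraction[OF fin s])
  also have "(\<lambda>e. - v e * u e + (1 - u e) * v e) = (\<lambda>e. v e * (1 - 2 * u e))"
    by (simp add: fun_eq_iff algebra_simps)
  finally show ?thesis .
qed


section \<open>Expectations over a random subset\<close>

lemma pmf_random_subset:
  assumes "finite E" "A \<subseteq> E" "\<And>e. e \<in> E \<Longrightarrow> 0 \<le> p e \<and> p e \<le> 1"
  shows "pmf (random_subset E p) A = (\<Prod>e\<in>A. p e) * (\<Prod>e\<in>E - A. 1 - p e)"
proof -
  have "(\<lambda>f. {e \<in> E. f e}) -` {A} = Pi E (\<lambda>e. {e \<in> A})"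
    using assms(2) by auto
  then have "pmf (random_subset E p) A = (\<Prod>e\<in>E. pmf (bernoulli_pmf (p e)) (e \<in> A))"
    using assms(1)
    by (simp add: random_subset_def pmf_map measure_Pi_pmf_Pi measure_pmf_single)
  also have "\<dots> = (\<Prod>e\<in>E - A. pmf (bernoulli_pmf (p e)) (e \<in> A))
                * (\<Prod>e\<in>A. pmf (bernoulli_pmf (p e)) (e \<in> A))"
    using assms by (intro prod.subset_diff) auto
  also have "\<dots> = (\<Prod>e\<in>E - A. 1 - p e) * (\<Prod>e\<in>A. p e)"
    using assms by (intro arg_cong2[where f = "(*)"] prod.cong) auto
  finally show ?thesis by (simp add: mult.commute)
qed

lemma expectation_random_subset:
  fixes f :: "'e set \<Rightarrow> real"
  assumes "finite E" "\<And>e. e \<in> E \<Longrightarrow> 0 \<le> p e \<and> p e \<le> 1"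
  shows "measure_pmf.expectation (random_subset E p) f
       = (\<Sum>A\<in>Pow E. f A * (\<Prod>e\<in>A. p e) * (\<Prod>e\<in>E - A. 1 - p e))"
proof -
  have "measure_pmf.expectation (random_subset E p) f
      = (\<Sum>A\<in>Pow E. f A * pmf (random_subset E p) A)"
    using assms(1) by (intro integral_measure_pmf_real) (auto simp: random_subset_def)
  then show ?thesis
    using assms by (simp add: pmf_random_subset mult.assoc)
qed

lemma expectation_Zpoly_contraction:
  fixes s :: real
  assumes "finite (ground M)" "s \<noteq> 0" "\<And>e. e \<in> ground M \<Longrightarrow> 0 \<le> p e \<and> p e \<le> 1"
  shows "measure_pmf.expectation (random_subset (ground M) p)
           (\<lambda>A. s powi (- rk M A) * (\<Prod>e\<in>A. - v e) * Zpoly \<iota> (contraction M A) s v)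
       = Zpoly_homog \<iota> M s (\<lambda>e. v e * (1 - 2 * p e)) (\<lambda>e. 1 - p e)"
  using assms by (simp add: expectation_random_subset flip: sum_Zpoly_contraction)

theorem theorem4p12:
  fixes M :: "('e, 'r::comm_ring_1) rsm" and N :: "('e, real) rsm"
  shows
    "(finite (ground M) \<longrightarrow>
       (let E = ground M;
            s = rf_var S_var :: ('e, 'r) ratfun;
            u = (\<lambda>e. rf_var (U_var e) :: ('e, 'r) ratfun);
            v = (\<lambda>e. rf_var (V_var e) :: ('e, 'r) ratfun)
        in (\<Prod>e\<in>E. 1 - u e) * Zpoly rf_const M s (\<lambda>e. v e * (1 - 2 * u e) / (1 - u e))
           = (\<Sum>A\<in>Pow E. s powi (- rk M A) * (\<Prod>e\<in>A. - v e)
                * Zpoly rf_const (contraction M A) s v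
                * (\<Prod>e\<in>A. u e) * (\<Prod>e\<in>E - A. 1 - u e))))
     \<and>
     (finite (ground N) \<longrightarrow>
       (\<forall>(s::real) (v::'e \<Rightarrow> real) (p::'e \<Rightarrow> real).
          s \<noteq> 0 \<and> (\<forall>e\<in>ground N. 0 \<le> p e \<and> p e \<le> 1) \<longrightarrow>
          (let E = ground N;
               expct = measure_pmf.expectation (random_subset E p)
                 (\<lambda>A. s powi (- rk N A) * (\<Prod>e\<in>A. - v e) * Zpoly id (contraction N A) s v)
           in ((\<forall>e\<in>E. p e \<noteq> 1) \<longrightarrow>
                 expct = (\<Prod>e\<in>E. 1 - p e) * Zpoly id N s (\<lambda>e. v e * (1 - 2 * p e) / (1 - p e)))
              \<and> expct = (\<Sum>A\<in>Pow E. rsm_mult N A * s powi (- rk N A)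
                          * (\<Prod>e\<in>A. v e * (1 - 2 * p e)) * (\<Prod>e\<in>E - A. 1 - p e)))))"
proof (unfold Let_def, intro conjI allI impI,
    goal_cases rational_functions expectation_quotient expectation_polynomial)
  case rational_functions
  then show ?case
    by (simp add: prod_mult_Zpoly sum_Zpoly_contraction rf_var_mult_inverse
        one_minus_rf_var_mult_divide)
next
  case (expectation_quotient s v p)
  then have "(\<Prod>e\<in>ground N. 1 - p e) * Zpoly id N s (\<lambda>e. v e * (1 - 2 * p e) / (1 - p e))
      = Zpoly_homog id N s (\<lambda>e. v e * (1 - 2 * p e)) (\<lambda>e. 1 - p e)"
    by (intro prod_mult_Zpoly) auto
  with expectation_quotient show ?case
    by (simp add: expectation_Zpoly_contraction)
next
  case (expectation_polynomial s v p)
  then show ?case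
    by (simp add: expectation_Zpoly_contraction Zpoly_homog_def)
qed

end
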